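(* Let $0<\mu\le\lambda_1$, let $0\le\ell\le k<n-1$ be integers and let $\tau>0$. Then $$\frac{\Omega_{\ell:k}^{(\mu)}-\varepsilon_\ell}{\varepsilon_\ell}<\frac{\Omega_{\ell:k}^{(\mu)}-\Delta_{\ell:k}}{\Delta_{\ell:k}}=\frac{\|r_k\|^2\left(\gamma_k^{(\mu)}-\gamma_k\right)}{\Delta_{\ell:k}}$$ and $$\frac{\Omega_{\ell:k}^{(\mu)}-\varepsilon_\ell}{\varepsilon_\ell}+\frac{\varepsilon_\ell-\Delta_{\ell:k}}{\varepsilon_\ell}<\frac{\Omega_{\ell:k}^{(\mu)}-\Delta_{\ell:k}}{\Delta_{\ell:k}}.$$ Consequently, if $$\frac{\|r_k\|^2\left(\gamma_k^{(\mu)}-\gamma_k\right)}{\Delta_{\ell:k}}\le\tau,$$ then $$\frac{\Omega_{\ell:k}^{(\mu)}-\varepsilon_\ell}{\varepsilon_\ell}\le\tau,$$ and moreover $\tau$ is an upper bound on the sum of relative errors $$\frac{\Omega_{\ell:k}^{(\mu)}-\varepsilon_\ell}{\varepsilon_\ell}+\frac{\varepsilon_\ell-\Delta_{\ell:k}}{\varepsilon_\ell}.$$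
   Context: Let $A\in\mathbb{R}^{N\times N}$ be symmetric positive definite with simple eigenvalues $\lambda_1<\dots<\lambda_N$, let $b,x_0\in\mathbb{R}^N$, let $x=A^{-1}b$, and consider the conjugate gradient (CG) method in exact arithmetic: $r_0=b-Ax_0\neq 0$, $p_0=r_0$, and for $k=1,2,\dots$ $$\gamma_{k-1}=\frac{r_{k-1}^Tr_{k-1}}{p_{k-1}^TAp_{k-1}},\quad x_k=x_{k-1}+\gamma_{k-1}p_{k-1},\quad r_k=r_{k-1}-\gamma_{k-1}Ap_{k-1},\quad \delta_k=\frac{r_k^Tr_k}{r_{k-1}^Tr_{k-1}},\quad p_k=r_k+\delta_kp_{k-1}.$$ Let $n$ be the grade of $r_0$ with respect to $A$, i.e. the maximal dimension of the Krylov subspaces $\mathrm{span}\{r_0,Ar_0,\dots,A^{k-1}r_0\}$. Write $\|y\|_A=(y^TAy)^{1/2}$ and $\varepsilon_j=\|x-x_j\|_A^2$. For $0<\mu\le\lambda_1$ the Gauss-Radau coefficients are given by $$\gamma_0^{(\mu)}=\frac1\mu,\qquad \gamma_{j+1}^{(\mu)}=\frac{\gamma_j^{(\mu)}-\gamma_j}{\mu(\gamma_j^{(\mu)}-\gamma_j)+\delta_{j+1}}.$$ Define $\Delta_j=\gamma_j\|r_j\|^2$, $\Delta_{\ell:k}=\sum_{j=\ell}^k\Delta_j$, $\Delta_{j:j-1}=0$ (so $\Delta_{\ell:k}$ is the improved Gauss lower bound on $\varepsilon_\ell$), and the improved Gauss-Radau upper bound $$\Omega_{\ell:k}^{(\mu)}=\Delta_{\ell:k-1}+\gamma_k^{(\mu)}\|r_k\|^2.$$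 The basic quadrature bounds, known from earlier work, are $\gamma_k\|r_k\|^2\le\|x-x_k\|_A^2<\gamma_k^{(\mu)}\|r_k\|^2$ for $k<n-1$ and $0<\mu\le\lambda_1$. *)

theory Defs
  imports "HOL-Analysis.Analysis"
begin

definition symmetric_matrix :: "real^'n^'n \<Rightarrow> bool" where
  "symmetric_matrix A \<longleftrightarrow> transpose A = A"

definition positive_definite :: "real^'n^'n \<Rightarrow> bool" where
  "positive_definite A \<longleftrightarrow> (\<forall>v. v \<noteq> 0 \<longrightarrow> 0 < v \<bullet> (A *v v))"

definition eigenvalue :: "real^'n^'n \<Rightarrow> real \<Rightarrow> bool" where
  "eigenvalue A c \<longleftrightarrow> (\<exists>v. v \<noteq> 0 \<and> A *v v = c *\<^sub>R v)"

text \<open>All eigenvalues are simple and \<open>l 1 < ... < l N\<close> lists them, \<open>N\<close> being the dimension: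
  \<open>N\<close> distinct eigenvalues of an \<open>N \<times> N\<close> matrix all have multiplicity one. The index starts at 1.\<close>

definition simple_eigenvalues :: "real^'n^'n \<Rightarrow> (nat \<Rightarrow> real) \<Rightarrow> bool" where
  "simple_eigenvalues A l \<longleftrightarrow>
     strict_mono_on {1..CARD('n)} l \<and> {c. eigenvalue A c} = l ` {1..CARD('n)}"

definition energy_norm :: "real^'n^'n \<Rightarrow> real^'n \<Rightarrow> real" where
  "energy_norm A y = sqrt (y \<bullet> (A *v y))"

definition krylov :: "real^'n^'n \<Rightarrow> real^'n \<Rightarrow> nat \<Rightarrow> (real^'n) set" where
  "krylov A v k = span ((\<lambda>i. (((*v) A) ^^ i) v) ` {..<k})"

definition grade :: "real^'n^'n \<Rightarrow> real^'n \<Rightarrow> nat" where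
  "grade A v = Max (range (\<lambda>k. dim (krylov A v k)))"

text \<open>The state of the iteration is the triple \<open>(x\<^sub>k, r\<^sub>k, p\<^sub>k)\<close>. After breakdown
  (\<open>r\<^sub>k = 0\<close>, that is \<open>k\<close> at least the grade) the values are an artefact of division by zero.\<close>

fun cg :: "real^'n^'n \<Rightarrow> real^'n \<Rightarrow> real^'n \<Rightarrow> nat \<Rightarrow> (real^'n) \<times> (real^'n) \<times> (real^'n)" where
  "cg A b x0 0 = (x0, b - A *v x0, b - A *v x0)"
| "cg A b x0 (Suc k) =
     (let (x, r, p) = cg A b x0 k;
          \<gamma> = (r \<bullet> r) / (p \<bullet> (A *v p));
          r' = r - \<gamma> *\<^sub>R (A *v p);
          \<delta> = (r' \<bullet> r') / (r \<bullet> r)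
      in (x + \<gamma> *\<^sub>R p, r', r' + \<delta> *\<^sub>R p))"

definition cg_x :: "real^'n^'n \<Rightarrow> real^'n \<Rightarrow> real^'n \<Rightarrow> nat \<Rightarrow> real^'n" where
  "cg_x A b x0 k = fst (cg A b x0 k)"

definition cg_r :: "real^'n^'n \<Rightarrow> real^'n \<Rightarrow> real^'n \<Rightarrow> nat \<Rightarrow> real^'n" where
  "cg_r A b x0 k = fst (snd (cg A b x0 k))"

definition cg_p :: "real^'n^'n \<Rightarrow> real^'n \<Rightarrow> real^'n \<Rightarrow> nat \<Rightarrow> real^'n" where
  "cg_p A b x0 k = snd (snd (cg A b x0 k))"

definition cg_gamma :: "real^'n^'n \<Rightarrow> real^'n \<Rightarrow> real^'n \<Rightarrow> nat \<Rightarrow> real" where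
  "cg_gamma A b x0 k =
     (cg_r A b x0 k \<bullet> cg_r A b x0 k) / (cg_p A b x0 k \<bullet> (A *v cg_p A b x0 k))"

text \<open>Meaningful for \<open>k \<ge> 1\<close> only.\<close>

definition cg_delta :: "real^'n^'n \<Rightarrow> real^'n \<Rightarrow> real^'n \<Rightarrow> nat \<Rightarrow> real" where
  "cg_delta A b x0 k =
     (cg_r A b x0 k \<bullet> cg_r A b x0 k) / (cg_r A b x0 (k - 1) \<bullet> cg_r A b x0 (k - 1))"

lemma cg_init:
  "cg_x A b x0 0 = x0"
  "cg_r A b x0 0 = b - A *v x0"
  "cg_p A b x0 0 = cg_r A b x0 0"
  by (simp_all add: cg_x_def cg_r_def cg_p_def)

lemma cg_step:
  "cg_x A b x0 (Suc k) = cg_x A b x0 k + cg_gamma A b x0 k *\<^sub>R cg_p A b x0 k"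
  "cg_r A b x0 (Suc k) = cg_r A b x0 k - cg_gamma A b x0 k *\<^sub>R (A *v cg_p A b x0 k)"
  "cg_p A b x0 (Suc k) = cg_r A b x0 (Suc k) + cg_delta A b x0 (Suc k) *\<^sub>R cg_p A b x0 k"
  by (simp_all add: cg_x_def cg_r_def cg_p_def cg_gamma_def cg_delta_def Let_def split_beta)

fun radau_coeff :: "real^'n^'n \<Rightarrow> real^'n \<Rightarrow> real^'n \<Rightarrow> real \<Rightarrow> nat \<Rightarrow> real" where
  "radau_coeff A b x0 \<mu> 0 = 1 / \<mu>"
| "radau_coeff A b x0 \<mu> (Suc j) =
     (radau_coeff A b x0 \<mu> j - cg_gamma A b x0 j)
       / (\<mu> * (radau_coeff A b x0 \<mu> j - cg_gamma A b x0 j) + cg_delta A b x0 (Suc j))"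

definition cg_error :: "real^'n^'n \<Rightarrow> real^'n \<Rightarrow> real^'n \<Rightarrow> nat \<Rightarrow> real" where
  "cg_error A b x0 j = (energy_norm A (matrix_inv A *v b - cg_x A b x0 j))\<^sup>2"

definition gauss_term :: "real^'n^'n \<Rightarrow> real^'n \<Rightarrow> real^'n \<Rightarrow> nat \<Rightarrow> real" where
  "gauss_term A b x0 j = cg_gamma A b x0 j * (norm (cg_r A b x0 j))\<^sup>2"

definition gauss_lower :: "real^'n^'n \<Rightarrow> real^'n \<Rightarrow> real^'n \<Rightarrow> nat \<Rightarrow> nat \<Rightarrow> real" where
  "gauss_lower A b x0 l k = (\<Sum>j = l..k. gauss_term A b x0 j)"

text \<open>The sum over \<open>{l..<k}\<close> is the sum from \<open>l\<close> to \<open>k - 1\<close>, empty for \<open>k = l\<close>;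
  truncated subtraction would go wrong at \<open>l = k = 0\<close>.\<close>

definition radau_upper ::
  "real^'n^'n \<Rightarrow> real^'n \<Rightarrow> real^'n \<Rightarrow> real \<Rightarrow> nat \<Rightarrow> nat \<Rightarrow> real" where
  "radau_upper A b x0 \<mu> l k =
     (\<Sum>j = l..<k. gauss_term A b x0 j) + radau_coeff A b x0 \<mu> k * (norm (cg_r A b x0 k))\<^sup>2"

end

theory Submission
  imports Defs
begin

text \<open>
  The energy error drops by exactly \<open>\<gamma>\<^sub>j \<parallel>r\<^sub>j\<parallel>\<^sup>2\<close> in step \<open>j\<close>, so \<open>\<epsilon>\<^sub>l\<close> exceeds \<open>\<Delta>\<^sub>l\<^sub>:\<^sub>k\<close> by
  \<open>\<epsilon>\<^sub>k\<^sub>+\<^sub>1 > 0\<close>. The two relative errors add up to \<open>(\<Omega> - \<Delta>) / \<epsilon>\<close>, so what remains is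
  \<open>\<Omega> > \<Delta>\<close>, that is \<open>\<gamma>\<^sub>k < \<gamma>\<^sub>k\<^sup>\<mu>\<close>. This holds because \<open>1 / \<gamma>\<^sub>k - 1 / \<gamma>\<^sub>k\<^sup>\<mu>\<close> is, up to
  a positive factor, the value of the quadratic form of \<open>A - \<mu> I\<close> at a vector of a Krylov
  subspace. The form is positive semidefinite, and before the last CG step no nonzero vector
  of the Krylov subspace is an eigenvector.
\<close>

section \<open>Symmetric semidefinite forms and the Rayleigh quotient\<close>

lemma symmetric_matrix_inner:
  fixes A :: "real^'n^'n"
  assumes "symmetric_matrix A"
  shows "u \<bullet> (A *v v) = (A *v u) \<bullet> v"
  using assms unfolding symmetric_matrix_def
  by (metis dot_lmul_matrix transpose_matrix_vector)

text \<open>Moving from \<open>u\<close> against the eigen-residual \<open>w\<close> changes the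
  form of A - c I by -2 t (w \<bullet> w) to first order in t, so the form would become negative
  unless \<open>w\<close> is zero.\<close>

lemma positive_semidefinite_null_vector:
  fixes A :: "real^'n^'n"
  assumes sym: "symmetric_matrix A"
    and psd: "\<And>v. c * (v \<bullet> v) \<le> v \<bullet> (A *v v)"
    and eq: "u \<bullet> (A *v u) = c * (u \<bullet> u)"
  shows "A *v u = c *\<^sub>R u"
proof (rule ccontr)
  define w where "w = A *v u - c *\<^sub>R u"
  define K where "K = w \<bullet> (A *v w) - c * (w \<bullet> w)"
  assume "A *v u \<noteq> c *\<^sub>R u"
  then have w: "w \<bullet> w > 0" by (simp add: w_def)
  have K: "K \<ge> 0" using psd[of w] by (simp add: K_def)
  have quad: "0 \<le> t\<^sup>2 * K - 2 * t * (w \<bullet> w)" for t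
  proof -
    have uw: "u \<bullet> (A *v w) = (A *v u) \<bullet> w" by (rule symmetric_matrix_inner[OF sym])
    have "w \<bullet> w = (A *v u - c *\<^sub>R u) \<bullet> w" by (simp only: w_def)
    then have ww: "(A *v u) \<bullet> w = w \<bullet> w + c * (u \<bullet> w)"
      by (simp add: inner_diff_left)
    have wu: "w \<bullet> (A *v u) = (A *v u) \<bullet> w" "w \<bullet> u = u \<bullet> w" by (simp_all add: inner_commute)
    have "(u - t *\<^sub>R w) \<bullet> (A *v (u - t *\<^sub>R w)) - c * ((u - t *\<^sub>R w) \<bullet> (u - t *\<^sub>R w))
        = t\<^sup>2 * K - 2 * t * (w \<bullet> w)"
      unfolding matrix_vector_mult_diff_distrib matrix_vector_mult_scaleR inner_diff_left
        inner_diff_right inner_scaleR_left inner_scaleR_right uw eq wu ww K_def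
      by (simp add: power2_eq_square algebra_simps)
    with psd[of "u - t *\<^sub>R w"] show ?thesis by simp
  qed
  \<comment> \<open>The shift by 1 keeps the denominator positive when \<open>K\<close> is 0 and
    still gives t K \<le> w \<bullet> w.\<close>
  define t where "t = (w \<bullet> w) / (K + 1)"
  have t: "t > 0" using w K by (simp add: t_def)
  have "t * K < 2 * (w \<bullet> w)"
  proof -
    have "t * K \<le> t * (K + 1)" using t by simp
    also have "\<dots> = w \<bullet> w" using K by (simp add: t_def)
    finally show ?thesis using w by linarith
  qed
  then have "t * (t * K) < t * (2 * (w \<bullet> w))" using t by simp
  with quad[of t] show False by (simp add: power2_eq_square algebra_simps)
qed

text \<open>The constant is the minimum of the form on the compact unit sphere; a minimiser is a
  null vector of the shifted form, hence an eigenvector.\<close>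

lemma rayleigh_minimum_eigenvalue:
  fixes A :: "real^'n^'n"
  assumes sym: "symmetric_matrix A"
  obtains c where "eigenvalue A c" "\<And>v. c * (v \<bullet> v) \<le> v \<bullet> (A *v v)"
proof -
  have "continuous_on (sphere 0 1) (\<lambda>v. v \<bullet> (A *v v))"
    by (intro continuous_intros linear_continuous_on matrix_vector_mul_bounded_linear)
  moreover have "sphere (0::real^'n) 1 \<noteq> {}" by simp
  ultimately obtain u where u: "u \<in> sphere 0 1"
    and min: "\<And>v. v \<in> sphere 0 1 \<Longrightarrow> u \<bullet> (A *v u) \<le> v \<bullet> (A *v v)"
    using continuous_attains_inf[of "sphere (0::real^'n) 1" "\<lambda>v. v \<bullet> (A *v v)"] by auto
  define c where "c = u \<bullet> (A *v u)"
  have psd: "c * (v \<bullet> v) \<le> v \<bullet> (A *v v)" for v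
  proof (cases "v = 0")
    case False
    then have "c \<le> (v /\<^sub>R norm v) \<bullet> (A *v (v /\<^sub>R norm v))"
      unfolding c_def by (intro min) simp
    also have "\<dots> = (v \<bullet> (A *v v)) / (norm v)\<^sup>2"
      by (simp add: matrix_vector_mult_scaleR power2_eq_square field_simps)
    finally show ?thesis
      using False by (simp add: pos_le_divide_eq dot_square_norm)
  qed simp
  have uu: "u \<bullet> u = 1" using u by (simp add: dot_square_norm)
  then have "A *v u = c *\<^sub>R u"
    by (intro positive_semidefinite_null_vector[OF sym psd]) (simp add: c_def)
  moreover have "u \<noteq> 0" using uu by auto
  ultimately have "eigenvalue A c" by (auto simp: eigenvalue_def)
  with psd show thesis using that by blast
qed

text \<open>The eigenvalue list enters the argument only here: the least Rayleigh value is some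
  \<open>lam i\<close>, hence at least \<open>lam 1\<close>.\<close>

lemma rayleigh_lower_bound:
  fixes A :: "real^'n^'n"
  assumes "symmetric_matrix A" "simple_eigenvalues A lam" "\<mu> \<le> lam 1"
  shows "\<mu> * (v \<bullet> v) \<le> v \<bullet> (A *v v)"
proof -
  obtain c where "eigenvalue A c" and c: "\<And>v. c * (v \<bullet> v) \<le> v \<bullet> (A *v v)"
    using rayleigh_minimum_eigenvalue[OF assms(1)] by blast
  with assms(2) obtain i where i: "i \<in> {1..CARD('n)}" "c = lam i"
    unfolding simple_eigenvalues_def by blast
  have "lam 1 \<le> lam i"
    using assms(2) i unfolding simple_eigenvalues_def strict_mono_on_def
    by (cases "i = 1") (auto intro!: less_imp_le)
  with assms(3) i have "\<mu> \<le> c" by simp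
  then have "\<mu> * (v \<bullet> v) \<le> c * (v \<bullet> v)" by (intro mult_right_mono) auto
  with c[of v] show ?thesis by simp
qed

lemma grade_le_dim_invariant_subspace:
  fixes A :: "real^'n^'n"
  assumes S: "subspace S" "\<And>w. w \<in> S \<Longrightarrow> A *v w \<in> S" and v: "v \<in> S"
  shows "grade A v \<le> dim S"
proof -
  have "(((*v) A) ^^ i) v \<in> S" for i
    by (induction i) (auto simp: v S(2))
  then have "krylov A v k \<subseteq> S" for k
    unfolding krylov_def by (intro span_minimal S(1)) auto
  then have le: "dim (krylov A v k) \<le> dim S" for k
    by (rule dim_subset)
  \<comment> \<open>\<open>Max\<close> says something about the dimensions only once their set is
    known to be finite.\<close>
  then have "finite (range (\<lambda>k. dim (krylov A v k)))"
    by (auto intro: finite_subset[where B = "{..dim S}"])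
  then show ?thesis unfolding grade_def using le by (subst Max_le_iff) auto
qed

section \<open>Orthogonality and conjugacy in the CG iteration\<close>

locale cg_iteration =
  fixes A :: "real^'n^'n" and b x0 :: "real^'n"
  assumes sym: "symmetric_matrix A" and pos_def: "positive_definite A"
begin

abbreviation r where "r \<equiv> cg_r A b x0"
abbreviation p where "p \<equiv> cg_p A b x0"
abbreviation \<gamma> where "\<gamma> \<equiv> cg_gamma A b x0"
abbreviation \<delta> where "\<delta> \<equiv> cg_delta A b x0"
abbreviation x where "x \<equiv> cg_x A b x0"

lemma inner_swap: "u \<bullet> (A *v v) = (A *v u) \<bullet> v"
  by (rule symmetric_matrix_inner[OF sym])

lemma inner_swap': "u \<bullet> (A *v v) = v \<bullet> (A *v u)"
  by (metis inner_swap inner_commute)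

lemma A_pos: "v \<noteq> 0 \<Longrightarrow> 0 < v \<bullet> (A *v v)"
  using pos_def by (simp add: positive_definite_def)

text \<open>Orthogonality is a hypothesis here and in the next lemma because both serve inside the
  induction that establishes it.\<close>

lemma p_inner_r_of_orthogonal:
  assumes "\<And>i. i < m \<Longrightarrow> p i \<bullet> r m = 0"
  shows "p m \<bullet> r m = r m \<bullet> r m"
proof (cases m)
  case (Suc j)
  then show ?thesis using assms[of j] by (simp add: cg_step(3) inner_add_left)
qed (simp add: cg_init)

lemma gamma_pos_of_orthogonal:
  assumes "\<And>i. i < m \<Longrightarrow> p i \<bullet> r m = 0" "r m \<noteq> 0"
  shows "\<gamma> m > 0" "p m \<bullet> (A *v p m) = (r m \<bullet> r m) / \<gamma> m"
proof -
  have "p m \<noteq> 0" using p_inner_r_of_orthogonal[OF assms(1)] assms(2) by auto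
  then have "p m \<bullet> (A *v p m) > 0" by (rule A_pos)
  with assms(2) show "\<gamma> m > 0" "p m \<bullet> (A *v p m) = (r m \<bullet> r m) / \<gamma> m"
    by (simp_all add: cg_gamma_def)
qed

text \<open>The two relations need each other: conjugacy of earlier directions makes
  \<open>r m\<close> orthogonal to them, hence to the earlier residuals, and this makes
  \<open>p m\<close> conjugate because A p i is a multiple of r i - r (Suc i). The residual
  \<open>r m\<close> itself may vanish.\<close>

lemma p_orthogonal:
  assumes "\<And>i. i < m \<Longrightarrow> r i \<noteq> 0" "i < m"
  shows "p i \<bullet> r m = 0 \<and> p i \<bullet> (A *v p m) = 0"
  using assms
proof (induction m arbitrary: i rule: less_induct)
  case (less m)
  then obtain j where m: "m = Suc j" by (cases m) auto
  have g: "\<gamma> i > 0" "p i \<bullet> (A *v p i) = (r i \<bullet> r i) / \<gamma> i" if "i \<le> j" for i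
    using gamma_pos_of_orthogonal[of i] less.IH[of i] less.prems(1) that m by auto
  have pr: "p j \<bullet> r j = r j \<bullet> r j"
    using less.IH[of j] less.prems(1) m by (intro p_inner_r_of_orthogonal) auto
  have orth: "p i \<bullet> r m = 0" if "i \<le> j" for i
  proof (cases "i = j")
    case True
    then show ?thesis using g[of j] pr by (simp add: m cg_step(2) inner_diff_right)
  next
    case False
    then show ?thesis using that less.IH[of j i] less.prems(1) m
      by (simp add: cg_step(2) inner_diff_right)
  qed
  have r_eq: "r 0 = p 0" "\<And>i. r (Suc i) = p (Suc i) - \<delta> (Suc i) *\<^sub>R p i"
    by (simp_all add: cg_init cg_step(3))
  have rorth: "r i \<bullet> r m = 0" if "i \<le> j" for i
  proof (cases i)
    case 0
    then show ?thesis using orth[of 0] by (simp add: r_eq)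
  next
    case (Suc i')
    then show ?thesis using orth[of i] orth[of i'] that
      unfolding Suc r_eq(2)[of i'] inner_diff_left inner_scaleR_left by simp
  qed
  have i: "i \<le> j" using less.prems(2) m by simp
  have Ap: "A *v p i = (r i - r (Suc i)) /\<^sub>R \<gamma> i"
    using g(1)[OF i] by (simp add: cg_step(2))
  have split: "p i \<bullet> (A *v p m) = (A *v p i) \<bullet> r m + \<delta> m * (p i \<bullet> (A *v p j))"
    unfolding m cg_step(3)
    by (simp add: matrix_vector_right_distrib matrix_vector_mult_scaleR inner_add_right inner_swap)
  have "p i \<bullet> (A *v p m) = 0"
  proof (cases "i = j")
    \<comment> \<open>For the last direction both summands survive; \<open>\<delta> m\<close> is
      exactly the coefficient that cancels them.\<close>
    case True
    have "(A *v p j) \<bullet> r m = - (r m \<bullet> r m) / \<gamma> j"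
      using Ap rorth[of j] True by (simp add: inner_diff_left m divide_inverse)
    moreover have "\<delta> m * (p j \<bullet> (A *v p j)) = (r m \<bullet> r m) / \<gamma> j"
      using g[of j] less.prems(1)[of j] m by (simp add: cg_delta_def)
    ultimately show ?thesis using split True by simp
  next
    case False
    then have "p i \<bullet> (A *v p j) = 0" using i less.IH[of j i] less.prems(1) m by auto
    moreover have "(A *v p i) \<bullet> r m = 0"
      using Ap rorth[of i] rorth[of "Suc i"] False i by (simp add: inner_diff_left)
    ultimately show ?thesis using split by simp
  qed
  with orth[OF i] show ?case by simp
qed

lemma p_inner_r_eq_0: "(\<And>i. i < m \<Longrightarrow> r i \<noteq> 0) \<Longrightarrow> i < m \<Longrightarrow> p i \<bullet> r m = 0"
  using p_orthogonal by blast

lemma p_conjugate: "(\<And>i. i < m \<Longrightarrow> r i \<noteq> 0) \<Longrightarrow> i < m \<Longrightarrow> p i \<bullet> (A *v p m) = 0"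
  using p_orthogonal by blast

lemma p_inner_r:
  assumes "\<And>i. i < m \<Longrightarrow> r i \<noteq> 0"
  shows "p m \<bullet> r m = r m \<bullet> r m"
  using p_inner_r_of_orthogonal p_inner_r_eq_0 assms by blast

lemma gamma_pos:
  assumes "\<And>i. i \<le> m \<Longrightarrow> r i \<noteq> 0"
  shows "\<gamma> m > 0"
  using assms by (intro gamma_pos_of_orthogonal p_inner_r_eq_0) auto

lemma p_energy:
  assumes "\<And>i. i \<le> m \<Longrightarrow> r i \<noteq> 0"
  shows "p m \<bullet> (A *v p m) = (r m \<bullet> r m) / \<gamma> m"
  using assms by (intro gamma_pos_of_orthogonal p_inner_r_eq_0) auto

lemma A_p:
  assumes "\<And>i. i \<le> m \<Longrightarrow> r i \<noteq> 0"
  shows "A *v p m = (r m - r (Suc m)) /\<^sub>R \<gamma> m"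
  using gamma_pos[of m, OF assms] by (simp add: cg_step(2))

lemma r_in_span_p: "r i \<in> span (p ` {..i})"
proof (cases i)
  case 0
  then show ?thesis by (auto intro: span_base simp: cg_init)
next
  case (Suc j)
  have "r i = p i - \<delta> i *\<^sub>R p j" by (simp add: Suc cg_step(3))
  moreover have "p i \<in> span (p ` {..i})" "p j \<in> span (p ` {..i})"
    by (auto intro: span_base simp: Suc)
  ultimately show ?thesis by (simp add: span_diff span_scale)
qed

lemma r_orthogonal:
  assumes "\<And>i. i < m \<Longrightarrow> r i \<noteq> 0" "i < m"
  shows "r i \<bullet> r m = 0"
proof -
  have "orthogonal (r m) (r i)"
  proof (rule orthogonal_to_span[OF r_in_span_p])
    fix y assume "y \<in> p ` {..i}"
    then show "orthogonal (r m) y"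
      using p_inner_r_eq_0[OF assms(1)] assms(2)
      by (auto simp: orthogonal_def inner_commute)
  qed
  then show ?thesis by (simp add: orthogonal_def inner_commute)
qed

section \<open>No breakdown before the grade is reached\<close>

text \<open>A p i is a combination of r i and r (Suc i). Once \<open>r m\<close> vanishes, the span
  of the first m directions is therefore invariant under A, and it contains the initial
  residual.\<close>

lemma grade_le_of_r_eq_0:
  assumes "r m = 0" "\<And>i. i < m \<Longrightarrow> r i \<noteq> 0" "m > 0"
  shows "grade A (b - A *v x0) \<le> m"
proof -
  define S where "S = span (p ` {..<m})"
  have r_in: "r i \<in> S" if "i \<le> m" for i
  proof (cases "i = m")
    case True
    then show ?thesis using assms(1) by (simp add: S_def span_zero)
  next
    case False
    then have "span (p ` {..i}) \<subseteq> S"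
      unfolding S_def using that by (intro span_mono) auto
    with r_in_span_p show ?thesis by blast
  qed
  have Ap: "A *v p i \<in> S" if "i < m" for i
  proof -
    have "A *v p i = (r i - r (Suc i)) /\<^sub>R \<gamma> i"
      using assms(2) that by (intro A_p) auto
    then show ?thesis
      using r_in[of i] r_in[of "Suc i"] that unfolding S_def
      by (auto intro!: span_scale span_diff)
  qed
  have inv: "A *v w \<in> S" if "w \<in> S" for w
    using that unfolding S_def
  proof (induction rule: span_induct)
    case base
    show ?case unfolding subspace_def
      by (auto simp: matrix_vector_right_distrib matrix_vector_mult_scaleR
          intro: span_add span_scale span_zero)
  next
    case (step w)
    then show ?case using Ap by (auto simp: S_def)
  qed
  have "b - A *v x0 \<in> S" using r_in[of 0] by (simp add: cg_init)
  then have "grade A (b - A *v x0) \<le> dim S"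
    using inv by (intro grade_le_dim_invariant_subspace) (auto simp: S_def)
  also have "\<dots> \<le> card (p ` {..<m})"
    unfolding S_def dim_span by (rule dim_le_card') simp
  also have "\<dots> \<le> m" using card_image_le[of "{..<m}" p] by simp
  finally show ?thesis .
qed

lemma r_nonzero:
  assumes "b - A *v x0 \<noteq> 0" "m < grade A (b - A *v x0)"
  shows "r m \<noteq> 0"
proof
  assume "r m = 0"
  define j where "j = (LEAST i. r i = 0)"
  have "r j = 0" "j \<le> m" "\<And>i. i < j \<Longrightarrow> r i \<noteq> 0"
    using \<open>r m = 0\<close> unfolding j_def by (auto intro: LeastI Least_le dest: not_less_Least)
  moreover from this have "j > 0" using assms(1) by (cases j) (auto simp: cg_init)
  ultimately show False using grade_le_of_r_eq_0[of j] assms(2) by simp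
qed

section \<open>Gauss-Radau coefficients as pivots of the shifted Jacobi matrix\<close>

text \<open>The factor in parentheses is a diagonal entry of the Jacobi matrix. It results from
  splitting the residual into two conjugate directions.\<close>

lemma r_energy:
  assumes "\<And>i. i \<le> Suc j \<Longrightarrow> r i \<noteq> 0"
  shows "r (Suc j) \<bullet> (A *v r (Suc j))
    = (r (Suc j) \<bullet> r (Suc j)) * (1 / \<gamma> (Suc j) + \<delta> (Suc j) / \<gamma> j)"
proof -
  have r: "r (Suc j) = p (Suc j) - \<delta> (Suc j) *\<^sub>R p j" by (simp add: cg_step(3))
  have conj: "p j \<bullet> (A *v p (Suc j)) = 0" using assms by (intro p_conjugate) auto
  have "r (Suc j) \<bullet> (A *v r (Suc j))
      = p (Suc j) \<bullet> (A *v p (Suc j)) + \<delta> (Suc j) * (\<delta> (Suc j) * (p j \<bullet> (A *v p j)))"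
    unfolding r using conj inner_swap'[of "p (Suc j)" "p j"]
    by (simp add: matrix_vector_mult_diff_distrib matrix_vector_mult_scaleR
        inner_diff_left inner_diff_right)
  also have "p (Suc j) \<bullet> (A *v p (Suc j)) = (r (Suc j) \<bullet> r (Suc j)) / \<gamma> (Suc j)"
    using assms by (intro p_energy) auto
  also have "p j \<bullet> (A *v p j) = (r j \<bullet> r j) / \<gamma> j"
    using assms by (intro p_energy) auto
  also have "\<delta> (Suc j) * ((r j \<bullet> r j) / \<gamma> j) = (r (Suc j) \<bullet> r (Suc j)) / \<gamma> j"
    using assms[of j] by (simp add: cg_delta_def)
  finally show ?thesis by (simp add: algebra_simps)
qed

text \<open>Both r (Suc j) and its image under A are orthogonal to all directions before
  \<open>p j\<close>, so only the component \<open>p j\<close> of \<open>s\<close>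
  contributes.\<close>

lemma inner_next_residual:
  assumes nz: "\<And>i. i \<le> j \<Longrightarrow> r i \<noteq> 0"
    and s: "s - p j \<in> span (p ` {..<j})"
  shows "r (Suc j) \<bullet> s = 0" "r (Suc j) \<bullet> (A *v s) = - (r (Suc j) \<bullet> r (Suc j)) / \<gamma> j"
proof -
  have pr: "r (Suc j) \<bullet> p i = 0" if "i \<le> j" for i
    using nz that p_inner_r_eq_0[of "Suc j" i] by (simp add: inner_commute less_Suc_eq_le)
  have rr: "r (Suc j) \<bullet> r i = 0" if "i \<le> j" for i
    using nz that r_orthogonal[of "Suc j" i] by (simp add: inner_commute less_Suc_eq_le)
  have Ap: "(A *v r (Suc j)) \<bullet> p i = (r (Suc j) \<bullet> (r i - r (Suc i))) / \<gamma> i" if "i \<le> j" for i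
    using A_p[of i] nz that
    by (simp add: inner_swap[symmetric] inner_diff_right divide_inverse)
  have "orthogonal (r (Suc j)) (s - p j)"
    using pr by (intro orthogonal_to_span[OF s]) (auto simp: orthogonal_def)
  then show "r (Suc j) \<bullet> s = 0"
    using pr[of j] by (simp add: orthogonal_def inner_diff_right)
  have "orthogonal (A *v r (Suc j)) (s - p j)"
    using Ap rr by (intro orthogonal_to_span[OF s]) (auto simp: orthogonal_def inner_diff_right)
  then show "r (Suc j) \<bullet> (A *v s) = - (r (Suc j) \<bullet> r (Suc j)) / \<gamma> j"
    using Ap[of j] rr[of j] by (simp add: orthogonal_def inner_diff_right inner_swap)
qed

text \<open>Strictness: if the form vanished at \<open>s\<close>, then \<open>s\<close> would be an
  eigenvector and A s would be orthogonal to r (Suc j), but their inner product is nonzero as long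
  as r (Suc j) is.\<close>

lemma radau_gt:
  assumes nz: "\<And>i. i \<le> Suc j \<Longrightarrow> r i \<noteq> 0"
    and s: "s - p j \<in> span (p ` {..<j})"
    and g: "g > 0"
    and e: "s \<bullet> (A *v s) - \<mu> * (s \<bullet> s) = (r j \<bullet> r j) * (1 / \<gamma> j - 1 / g)"
    and \<mu>: "\<And>v. \<mu> * (v \<bullet> v) \<le> v \<bullet> (A *v v)"
  shows "\<gamma> j < g"
proof -
  have nz': "\<And>i. i \<le> j \<Longrightarrow> r i \<noteq> 0" using nz by auto
  have \<gamma>: "\<gamma> j > 0" by (rule gamma_pos[OF nz'])
  have "s \<bullet> (A *v s) \<noteq> \<mu> * (s \<bullet> s)"
  proof
    assume "s \<bullet> (A *v s) = \<mu> * (s \<bullet> s)"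
    then have "A *v s = \<mu> *\<^sub>R s" by (rule positive_semidefinite_null_vector[OF sym \<mu>])
    then have "r (Suc j) \<bullet> (A *v s) = 0"
      using inner_next_residual(1)[OF nz' s] by simp
    then show False
      using inner_next_residual(2)[OF nz' s] \<gamma> nz[of "Suc j"] by simp
  qed
  with \<mu>[of s] e have "0 < (r j \<bullet> r j) * (1 / \<gamma> j - 1 / g)" by linarith
  moreover have "r j \<bullet> r j > 0" using nz[of j] by simp
  ultimately have "0 < 1 / \<gamma> j - 1 / g" by (rule zero_less_mult_pos)
  then have "inverse g < inverse (\<gamma> j)" by (simp add: inverse_eq_divide)
  then show ?thesis using g by (rule inverse_less_imp_less)
qed

text \<open>
  The number \<open>1 / \<gamma> j - 1 / \<gamma>\<^sup>\<mu> j\<close> is pivot number \<open>j\<close> of the LDL factorisation of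
  \<open>T - \<mu> I\<close>, \<open>T\<close> being the Jacobi matrix of the Lanczos process. The vector \<open>s\<close> comes from the
  residuals by Gram-Schmidt with respect to \<open>A - \<mu> I\<close>, so that the value of the form at \<open>s\<close> is this pivot times \<open>r j \<bullet> r j\<close>.
\<close>

lemma radau_pivot:
  assumes \<mu>: "\<mu> > 0" "\<And>v. \<mu> * (v \<bullet> v) \<le> v \<bullet> (A *v v)"
    and "\<And>i. i \<le> Suc j \<Longrightarrow> r i \<noteq> 0"
  shows "\<gamma> j < radau_coeff A b x0 \<mu> j \<and>
    (\<exists>s. s - p j \<in> span (p ` {..<j}) \<and>
      s \<bullet> (A *v s) - \<mu> * (s \<bullet> s) = (r j \<bullet> r j) * (1 / \<gamma> j - 1 / radau_coeff A b x0 \<mu> j))"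
  using assms(3)
proof (induction j)
  case 0
  have g: "\<gamma> 0 > 0" using 0 by (intro gamma_pos) auto
  have e: "p 0 \<bullet> (A *v p 0) - \<mu> * (p 0 \<bullet> p 0)
      = (r 0 \<bullet> r 0) * (1 / \<gamma> 0 - 1 / radau_coeff A b x0 \<mu> 0)"
    using p_energy[of 0] 0 by (simp add: cg_init(3) algebra_simps)
  have "\<gamma> 0 < radau_coeff A b x0 \<mu> 0"
    by (rule radau_gt[of 0 "p 0", OF _ _ _ e]) (use 0 \<mu> in \<open>auto simp: span_zero\<close>)
  with e show ?case by (auto simp: span_zero intro!: exI[of _ "p 0"])
next
  case (Suc j)
  let ?G = "radau_coeff A b x0 \<mu>"
  let ?B = "\<lambda>u v. u \<bullet> (A *v v) - \<mu> * (u \<bullet> v)"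
  obtain s where lt: "\<gamma> j < ?G j" and s: "s - p j \<in> span (p ` {..<j})"
    and e: "?B s s = (r j \<bullet> r j) * (1 / \<gamma> j - 1 / ?G j)"
    using Suc by auto
  define R where "R = r (Suc j) \<bullet> r (Suc j)"
  define d where "d = ?G j - \<gamma> j"
  have d: "d > 0" using lt by (simp add: d_def)
  have g: "\<gamma> j > 0" "\<gamma> (Suc j) > 0" using Suc.prems by (auto intro!: gamma_pos)
  have del: "\<delta> (Suc j) > 0" "\<delta> (Suc j) * (r j \<bullet> r j) = R"
    using Suc.prems[of j] Suc.prems[of "Suc j"] by (simp_all add: cg_delta_def R_def)
  have G: "?G (Suc j) = d / (\<mu> * d + \<delta> (Suc j))" by (simp add: d_def)
  have Gpos: "?G (Suc j) > 0" unfolding G using d del \<mu>(1) by (auto intro!: divide_pos_pos add_pos_pos)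
  \<comment> \<open>In reciprocal form the Radau recursion can be matched with the pivot
    recurrence.\<close>
  have Ginv: "1 / ?G (Suc j) = \<mu> + \<delta> (Suc j) / d" unfolding G using d by (simp add: add_divide_distrib)
  have nz: "\<And>i. i \<le> j \<Longrightarrow> r i \<noteq> 0" using Suc.prems by auto
  note next_r = inner_next_residual[OF nz s, folded R_def]
  \<comment> \<open>the Gram-Schmidt coefficient \<open>\<delta> / (\<gamma> e)\<close> with \<open>e = 1 / \<gamma> - 1 / \<gamma>\<^sup>\<mu>\<close>\<close>
  define c where "c = \<delta> (Suc j) * ?G j / d"
  define s' where "s' = r (Suc j) + c *\<^sub>R s"
  have "s' - p (Suc j) = c *\<^sub>R (s - p j) + (c - \<delta> (Suc j)) *\<^sub>R p j"
    by (simp add: s'_def cg_step(3) algebra_simps)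
  moreover have "s - p j \<in> span (p ` {..<Suc j})"
    using s span_mono[of "p ` {..<j}" "p ` {..<Suc j}"] by (auto simp: lessThan_Suc)
  ultimately have s': "s' - p (Suc j) \<in> span (p ` {..<Suc j})"
    by (auto intro!: span_add span_scale intro: span_base)
  have "?B s' s' = ?B (r (Suc j)) (r (Suc j)) + 2 * c * ?B (r (Suc j)) s + c\<^sup>2 * ?B s s"
    using inner_swap'[of s "r (Suc j)"] inner_commute[of s "r (Suc j)"]
    by (simp add: s'_def matrix_vector_right_distrib matrix_vector_mult_scaleR inner_add_left
        inner_add_right power2_eq_square algebra_simps)
  also have "?B (r (Suc j)) s = - R / \<gamma> j" using next_r by simp
  also have "?B (r (Suc j)) (r (Suc j)) = R * (1 / \<gamma> (Suc j) + \<delta> (Suc j) / \<gamma> j) - \<mu> * R"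
    using r_energy[OF Suc.prems, of j] Suc.prems by (simp add: R_def)
  \<comment> \<open>By the choice of \<open>c\<close>, the quadratic term cancels half of the cross
    term.\<close>
  also have "c\<^sup>2 * ?B s s = c * (R / \<gamma> j)"
  proof -
    have "1 / \<gamma> j - 1 / ?G j = d / (\<gamma> j * ?G j)"
      using g lt by (simp add: d_def field_simps)
    then have "c * (1 / \<gamma> j - 1 / ?G j) = \<delta> (Suc j) / \<gamma> j"
      using g lt d by (simp add: c_def)
    moreover have "c\<^sup>2 * ?B s s = c * ((c * (1 / \<gamma> j - 1 / ?G j)) * (r j \<bullet> r j))"
      unfolding e power2_eq_square by (simp only: mult.assoc mult.commute[of "r j \<bullet> r j"])
    ultimately show ?thesis by (simp flip: del(2))
  qed
  also have "R * (1 / \<gamma> (Suc j) + \<delta> (Suc j) / \<gamma> j) - \<mu> * R + 2 * c * (- R / \<gamma> j) + c * (R / \<gamma> j)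
      = R * (1 / \<gamma> (Suc j) - 1 / ?G (Suc j))"
  \<comment> \<open>The remaining half, R c / \<gamma> j, removes the \<delta> / \<gamma> part of
    the diagonal entry; what is left over combines with \<mu> R to R /
    \<open>?G (Suc j)\<close>.\<close>
  proof -
    have "c / \<gamma> j = \<delta> (Suc j) / \<gamma> j + \<delta> (Suc j) / d"
      using g d by (simp add: c_def d_def field_simps)
    then show ?thesis unfolding Ginv by algebra
  qed
  finally have e': "?B s' s' = R * (1 / \<gamma> (Suc j) - 1 / ?G (Suc j))" .
  have "\<gamma> (Suc j) < ?G (Suc j)"
    by (rule radau_gt[OF _ s' Gpos e'[unfolded R_def]]) (use Suc.prems \<mu> in auto)
  with e' s' show ?case by (auto simp: R_def)
qed

section \<open>The energy error and its decrease per step\<close>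

lemma cg_residual: "r k = b - A *v x k"
  by (induction k)
    (simp_all add: cg_init cg_step matrix_vector_right_distrib matrix_vector_mult_scaleR algebra_simps)

lemma A_error: "A *v (matrix_inv A *v b - x k) = r k"
proof -
  have "A *v v = 0 \<Longrightarrow> v = 0" for v using A_pos[of v] by force
  then have "invertible A"
    by (simp add: invertible_left_inverse matrix_left_invertible_ker)
  then have "A ** matrix_inv A = mat 1"
    unfolding invertible_def matrix_inv_def by (metis (mono_tags, lifting) someI_ex)
  then have "A *v (matrix_inv A *v b) = b"
    by (simp add: matrix_vector_mul_assoc)
  then show ?thesis by (simp add: matrix_vector_mult_diff_distrib cg_residual)
qed

lemma cg_error_eq: "cg_error A b x0 k = (matrix_inv A *v b - x k) \<bullet> r k"
proof -
  let ?e = "matrix_inv A *v b - x k"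
  \<comment> \<open>Nonnegativity lets the square undo the root in
    \<open>energy_norm\<close>.\<close>
  have "0 \<le> ?e \<bullet> (A *v ?e)" using A_pos[of ?e] by (cases "?e = 0") auto
  then show ?thesis by (simp add: cg_error_def energy_norm_def A_error)
qed

lemma cg_error_pos:
  assumes "r k \<noteq> 0"
  shows "cg_error A b x0 k > 0"
proof -
  have "matrix_inv A *v b - x k \<noteq> 0" using A_error[of k] assms by force
  then show ?thesis using A_pos[of "matrix_inv A *v b - x k"] by (simp add: cg_error_eq A_error)
qed

text \<open>Expanding the new error gives a cross term -2 \<gamma> (r \<bullet> r) and, since
  \<gamma> (p \<bullet> A p) = r \<bullet> r, a quadratic term +\<gamma> (r \<bullet> r).\<close>

lemma cg_error_Suc:
  assumes "\<And>i. i \<le> k \<Longrightarrow> r i \<noteq> 0"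
  shows "cg_error A b x0 k = cg_error A b x0 (Suc k) + gauss_term A b x0 k"
proof -
  let ?e = "matrix_inv A *v b - x k"
  have pr: "p k \<bullet> r k = r k \<bullet> r k" using assms by (intro p_inner_r) auto
  have eAp: "?e \<bullet> (A *v p k) = p k \<bullet> r k"
    using inner_swap'[of ?e "p k"] by (simp add: A_error)
  have "cg_error A b x0 (Suc k) = (?e - \<gamma> k *\<^sub>R p k) \<bullet> (r k - \<gamma> k *\<^sub>R (A *v p k))"
    by (simp add: cg_error_eq cg_step algebra_simps)
  also have "\<dots> = ?e \<bullet> r k - 2 * \<gamma> k * (r k \<bullet> r k) + \<gamma> k * (\<gamma> k * (p k \<bullet> (A *v p k)))"
    unfolding inner_diff_left[of ?e] inner_diff_right inner_scaleR_left inner_scaleR_right eAp pr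
    by (simp add: algebra_simps)
  also have "\<gamma> k * (p k \<bullet> (A *v p k)) = r k \<bullet> r k"
    using p_energy[of k, OF assms] gamma_pos[of k, OF assms] by simp
  finally show ?thesis by (simp add: cg_error_eq gauss_term_def dot_square_norm)
qed

lemma cg_error_gauss_lower:
  assumes "l \<le> k" "\<And>i. i \<le> k \<Longrightarrow> r i \<noteq> 0"
  shows "cg_error A b x0 l = cg_error A b x0 (Suc k) + gauss_lower A b x0 l k"
  using assms
proof (induction k rule: dec_induct)
  case base
  then show ?case using cg_error_Suc[of l] by (simp add: gauss_lower_def)
next
  case (step k)
  then show ?case using cg_error_Suc[of "Suc k"] by (simp add: gauss_lower_def)
qed

lemma gauss_term_pos:
  assumes "\<And>i. i \<le> k \<Longrightarrow> r i \<noteq> 0"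
  shows "gauss_term A b x0 k > 0"
  using gamma_pos[OF assms] assms[of k] by (simp add: gauss_term_def)

end

section \<open>Comparison of the relative errors\<close>

theorem mainTheorem2:
  fixes A :: "real^'n^'n" and b x0 :: "real^'n"
    and lam :: "nat \<Rightarrow> real" and \<mu> \<tau> :: real and l k :: nat
  assumes "symmetric_matrix A"
    and "positive_definite A"
    and "simple_eigenvalues A lam"
    and "b - A *v x0 \<noteq> 0"
    and "0 < \<mu>" and "\<mu> \<le> lam 1"
    and "l \<le> k" and "k < grade A (b - A *v x0) - 1"
    and "0 < \<tau>"
  shows "let \<epsilon> = cg_error A b x0 l;
             \<Delta> = gauss_lower A b x0 l k;
             \<Omega> = radau_upper A b x0 \<mu> l k;
             \<rho> = (norm (cg_r A b x0 k))\<^sup>2 * (radau_coeff A b x0 \<mu> k - cg_gamma A b x0 k) / \<Delta>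
         in (\<Omega> - \<epsilon>) / \<epsilon> < (\<Omega> - \<Delta>) / \<Delta> \<and>
            (\<Omega> - \<Delta>) / \<Delta> = \<rho> \<and>
            (\<Omega> - \<epsilon>) / \<epsilon> + (\<epsilon> - \<Delta>) / \<epsilon> < (\<Omega> - \<Delta>) / \<Delta> \<and>
            (\<rho> \<le> \<tau> \<longrightarrow>
               (\<Omega> - \<epsilon>) / \<epsilon> \<le> \<tau> \<and>
               (\<Omega> - \<epsilon>) / \<epsilon> + (\<epsilon> - \<Delta>) / \<epsilon> \<le> \<tau>)"
proof -
  interpret cg_iteration A b x0 using assms(1,2) by unfold_locales
  let ?\<epsilon> = "cg_error A b x0 l" and ?\<Delta> = "gauss_lower A b x0 l k"
  let ?\<Omega> = "radau_upper A b x0 \<mu> l k"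
  \<comment> \<open>The bound on \<open>k\<close> leaves room for one more nonzero residual, r (Suc
    k), on which both strict inequalities \<Delta> < \<epsilon> and \<Delta> < \<Omega>
    rest.\<close>
  have nz: "r i \<noteq> 0" if "i \<le> Suc k" for i
    using that assms(8) by (intro r_nonzero[OF assms(4)]) auto
  have \<Delta>_pos: "?\<Delta> > 0"
    unfolding gauss_lower_def using assms(7) nz by (intro sum_pos gauss_term_pos) auto
  have \<epsilon>: "?\<Delta> < ?\<epsilon>"
    using cg_error_gauss_lower[OF assms(7)] cg_error_pos[OF nz, of "Suc k"] nz by simp
  have gap: "?\<Omega> - ?\<Delta> = (norm (r k))\<^sup>2 * (radau_coeff A b x0 \<mu> k - \<gamma> k)"
  proof -
    have "{l..k} = insert k {l..<k}" using assms(7) by auto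
    then have "?\<Delta> = (\<Sum>j = l..<k. gauss_term A b x0 j) + gauss_term A b x0 k"
      by (simp add: gauss_lower_def)
    then show ?thesis by (simp add: radau_upper_def gauss_term_def algebra_simps)
  qed
  have "\<gamma> k < radau_coeff A b x0 \<mu> k"
    using radau_pivot[OF assms(5) rayleigh_lower_bound[OF assms(1,3,6)]] nz by blast
  then have "?\<Omega> - ?\<Delta> > 0" unfolding gap using nz[of k] by simp
  then have \<Omega>: "?\<Delta> < ?\<Omega>" by simp
  have sum_lt: "(?\<Omega> - ?\<epsilon>) / ?\<epsilon> + (?\<epsilon> - ?\<Delta>) / ?\<epsilon> < (?\<Omega> - ?\<Delta>) / ?\<Delta>"
  proof -
    have "(?\<Omega> - ?\<epsilon>) / ?\<epsilon> + (?\<epsilon> - ?\<Delta>) / ?\<epsilon> = (?\<Omega> - ?\<Delta>) / ?\<epsilon>"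
      by (simp flip: add_divide_distrib)
    also have "\<dots> < (?\<Omega> - ?\<Delta>) / ?\<Delta>"
      using \<Omega> \<epsilon> \<Delta>_pos by (intro divide_strict_left_mono mult_pos_pos) auto
    finally show ?thesis .
  qed
  \<comment> \<open>The Gauss error is positive, so dropping it from the sum yields the bound on the
    Radau error alone.\<close>
  moreover have "(?\<epsilon> - ?\<Delta>) / ?\<epsilon> > 0" using \<epsilon> \<Delta>_pos by simp
  ultimately have "(?\<Omega> - ?\<epsilon>) / ?\<epsilon> < (?\<Omega> - ?\<Delta>) / ?\<Delta>" by linarith
  with sum_lt show ?thesis unfolding Let_def gap by linarith
qed

end
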